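(* Let $L\ge 0$ and let $f:\mathbb{R}^d\to\mathbb{R}$ be a differentiable function. Then $f$ is $L$-smooth if and only if any one of the following conditions holds (that is, each of the three conditions is individually equivalent to $L$-smoothness of $f$): (a) $f(\lambda x+(1-\lambda)y)\ge \lambda f(x)+(1-\lambda)f(y)-\frac L2\lambda(1-\lambda)\|x-y\|^2$ for all $x,y\in\mathbb{R}^d$, $\lambda\in[0,1]$; (b) $\langle\nabla f(x)-\nabla f(y),x-y\rangle\le L\|x-y\|^2$ for all $x,y\in\mathbb{R}^d$; (c) $f(y)\le f(x)+\langle\nabla f(x),y-x\rangle+\frac L2\|x-y\|^2$ for all $x,y\in\mathbb{R}^d$.
   Context: $\mathbb{R}^d$ carries the dot product $\langle\cdot,\cdot\rangle$ and the induced Euclidean norm $\|\cdot\|$. For a differentiable function $h$, the Bregman distance is $D_h(x,y):=h(x)-h(y)-\langle\nabla h(y),x-y\rangle$. Let $\varphi_0=\frac12\|\cdot\|^2$. A differentiable function $f:\mathbb{R}^d\to\mathbb{R}$ (not necessarily convex) is called $L$-smooth if $D_f(x,y)\le L\,D_{\varphi_0}(x,y)$ for all $x,y\in\mathbb{R}^d$. *)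

theory Defs
  imports "HOL-Analysis.Analysis"
begin

text \<open>The gradient is the vector representing the Frechet derivative through the inner product;
  it is only meaningful where the function is differentiable.\<close>

definition gradient :: "('a::real_inner \<Rightarrow> real) \<Rightarrow> 'a \<Rightarrow> 'a" where
  "gradient h x = (THE D. GDERIV h x :> D)"

definition bregman :: "('a::real_inner \<Rightarrow> real) \<Rightarrow> 'a \<Rightarrow> 'a \<Rightarrow> real" where
  "bregman h x y = h x - h y - gradient h y \<bullet> (x - y)"

definition phi0 :: "'a::real_inner \<Rightarrow> real" where
  "phi0 x = 1 / 2 * (norm x)\<^sup>2"

definition L_smooth :: "real \<Rightarrow> ('a::real_inner \<Rightarrow> real) \<Rightarrow> bool" where
  "L_smooth L f \<longleftrightarrow>
     f differentiable_on UNIV \<and> (\<forall>x y. bregman f x y \<le> L * bregman phi0 x y)"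

end

theory Submission
  imports Defs
begin

text \<open>Put \<open>\<psi> = L \<phi>\<^sub>0 - f\<close>. Forming the Bregman distance is linear in the function, so
  \<open>L\<close>-smoothness of \<open>f\<close> says exactly that \<open>D\<^sub>\<psi> \<ge> 0\<close>, that is, \<open>\<psi>\<close> lies above all its tangent
  hyperplanes. For a differentiable function this is one of three classical descriptions of
  convexity, the other two being the chord inequality and monotonicity of the gradient. The
  proof goes round the cycle: convex implies above tangents
  (\<open>convex_imp_above_tangent_gradient\<close>), above tangents implies monotone gradient
  (\<open>above_tangent_imp_monotone_gradient\<close>), monotone gradient implies convex
  (\<open>monotone_gradient_imp_convex\<close>); the two steps that need analysis are reduced to functions of
  one real variable by restricting to lines.

  Written out in terms of \<open>f\<close>, the chord inequality for \<open>\<psi>\<close> is (a), because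
  \<open>\<parallel>l x + (1 - l) y\<parallel>\<^sup>2 = l \<parallel>x\<parallel>\<^sup>2 + (1 - l) \<parallel>y\<parallel>\<^sup>2 - l (1 - l) \<parallel>x - y\<parallel>\<^sup>2\<close>; monotonicity of
  \<open>\<nabla>\<psi> = L x - \<nabla>f\<close> is (b); and the tangent inequality is (c), because \<open>D\<^sub>\<phi>\<^sub>0(x, y)\<close> is
  \<open>\<parallel>x - y\<parallel>\<^sup>2 / 2\<close>.\<close>

section \<open>Gradients\<close>

lemma GDERIV_unique:
  assumes "GDERIV h x :> D" and "GDERIV h x :> E"
  shows "D = E"
proof -
  have "(\<lambda>v. v \<bullet> D) = (\<lambda>v. v \<bullet> E)"
    using assms unfolding gderiv_def by (rule has_derivative_unique)
  then have "(D - E) \<bullet> (D - E) = 0"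
    by (metis inner_diff_right right_minus_eq)
  then show ?thesis by simp
qed

lemma gradient_eqI: "GDERIV h x :> D \<Longrightarrow> gradient h x = D"
  unfolding gradient_def by (blast intro: the_equality GDERIV_unique)

text \<open>In finite dimension every linear functional is represented by a vector, here the adjoint
  applied to \<open>1\<close>; hence the definite description in \<^const>\<open>gradient\<close> denotes.\<close>

lemma differentiable_imp_GDERIV_gradient:
  fixes h :: "'a::euclidean_space \<Rightarrow> real"
  assumes "h differentiable at x"
  shows "GDERIV h x :> gradient h x"
proof -
  obtain h' where h': "(h has_derivative h') (at x)"
    using assms by (auto simp: differentiable_def)
  then have "h' = (\<lambda>v. v \<bullet> adjoint h' 1)"
    using adjoint_works[OF has_derivative_linear[OF h'], of _ 1] by auto
  with h' have "GDERIV h x :> adjoint h' 1"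
    unfolding gderiv_def by simp
  then show ?thesis
    by (simp add: gradient_eqI)
qed

lemma GDERIV_half_norm_squared:
  "GDERIV (\<lambda>x. c / 2 * (norm x)\<^sup>2) x :> c *\<^sub>R x"
  unfolding gderiv_def power2_norm_eq_inner
  by (auto intro!: derivative_eq_intros simp: inner_commute)

lemma bregman_phi0: "bregman phi0 x y = 1 / 2 * (norm (x - y))\<^sup>2"
proof -
  have "gradient phi0 y = y"
    using GDERIV_half_norm_squared[of 1 y] by (simp add: gradient_eqI phi0_def[abs_def])
  then show ?thesis
    unfolding bregman_def phi0_def power2_norm_eq_inner
    by (simp add: inner_diff inner_commute algebra_simps)
qed

section \<open>Convexity of differentiable functions\<close>

lemma GDERIV_along_line:
  assumes "GDERIV h (y + t *\<^sub>R d) :> D"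
  shows "((\<lambda>t. h (y + t *\<^sub>R d)) has_real_derivative D \<bullet> d) (at t)"
proof -
  have "((\<lambda>t. y + t *\<^sub>R d) has_derivative (\<lambda>s. s *\<^sub>R d)) (at t)"
    by (auto intro!: derivative_eq_intros)
  from has_derivative_compose[OF this assms[unfolded gderiv_def]]
  have "((\<lambda>t. h (y + t *\<^sub>R d)) has_derivative (\<lambda>s. (s *\<^sub>R d) \<bullet> D)) (at t)" .
  moreover have "(\<lambda>s. (s *\<^sub>R d) \<bullet> D) = (*) (D \<bullet> d)"
    by (auto simp: inner_commute)
  ultimately show ?thesis
    unfolding has_field_derivative_def by simp
qed

lemma convex_imp_above_tangent_gradient:
  assumes conv: "convex_on UNIV h" and D: "GDERIV h y :> D"
  shows "h y + D \<bullet> (x - y) \<le> h x"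
proof -
  define p where "p t = h (y + t *\<^sub>R (x - y))" for t
  have "convex_on UNIV p"
  proof (rule convex_onI)
    fix t a b :: real
    assume t: "0 < t" "t < 1"
    have "y + ((1 - t) * a + t * b) *\<^sub>R (x - y)
        = (1 - t) *\<^sub>R (y + a *\<^sub>R (x - y)) + t *\<^sub>R (y + b *\<^sub>R (x - y))"
      by (simp add: algebra_simps)
    then show "p ((1 - t) *\<^sub>R a + t *\<^sub>R b) \<le> (1 - t) * p a + t * p b"
      using convex_onD[OF conv] t by (simp add: p_def)
  qed simp
  moreover have "(p has_real_derivative D \<bullet> (x - y)) (at 0)"
    unfolding p_def[abs_def] by (rule GDERIV_along_line) (simp add: D)
  ultimately have "D \<bullet> (x - y) * (1 - 0) \<le> p 1 - p 0"
    by (intro convex_on_imp_above_tangent[of UNIV]) auto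
  then show ?thesis
    by (simp add: p_def)
qed

text \<open>Adding the tangent inequalities at the two points cancels the function values.\<close>

lemma above_tangent_imp_monotone_gradient:
  fixes G :: "'a::real_inner \<Rightarrow> 'a"
  assumes tangent: "\<And>x y. h y + G y \<bullet> (x - y) \<le> h x"
  shows "0 \<le> (G x - G y) \<bullet> (x - y)"
  using tangent[of x y] tangent[of y x] by (simp add: inner_diff algebra_simps)

lemma monotone_gradient_imp_convex:
  assumes D: "\<And>x. GDERIV h x :> G x"
    and mono: "\<And>x y. 0 \<le> (G x - G y) \<bullet> (x - y)"
  shows "convex_on UNIV h"
proof (rule convex_onI)
  fix t :: real and x y
  assume t: "0 < t" "t < 1"
  define p where "p s = h (x + s *\<^sub>R (y - x))" for s
  define p' where "p' s = G (x + s *\<^sub>R (y - x)) \<bullet> (y - x)" for s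
  have "convex_on UNIV p"
  proof (rule convex_on_realI)
    show "(p has_real_derivative p' s) (at s)" for s
      unfolding p_def[abs_def] p'_def by (rule GDERIV_along_line) (rule D)
    fix a b :: real
    assume "a \<le> b"
    \<comment> \<open>The two points on the line differ by \<open>(b - a) (y - x)\<close>, so monotonicity of \<open>G\<close> gives
      monotonicity of \<open>p'\<close> up to the factor \<open>b - a\<close>.\<close>
    have "0 \<le> (b - a) * (p' b - p' a)"
      using mono[of "x + b *\<^sub>R (y - x)" "x + a *\<^sub>R (y - x)"]
      by (simp add: p'_def inner_diff_left flip: scaleR_left_diff_distrib)
    with \<open>a \<le> b\<close> show "p' a \<le> p' b"
      by (cases "a = b") (auto simp: zero_le_mult_iff)
  qed simp
  from convex_onD[OF this, of t 0 1] t have "p t \<le> (1 - t) * p 0 + t * p 1"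
    by simp
  moreover have "x + t *\<^sub>R (y - x) = (1 - t) *\<^sub>R x + t *\<^sub>R y"
    by (simp add: algebra_simps)
  ultimately show "h ((1 - t) *\<^sub>R x + t *\<^sub>R y) \<le> (1 - t) * h x + t * h y"
    by (simp add: p_def)
qed simp

section \<open>Smoothness as convexity\<close>

lemma norm_squared_convex_combination:
  fixes x y :: "'a::real_inner"
  shows "(norm (l *\<^sub>R x + (1 - l) *\<^sub>R y))\<^sup>2
    = l * (norm x)\<^sup>2 + (1 - l) * (norm y)\<^sup>2 - l * (1 - l) * (norm (x - y))\<^sup>2"
  unfolding power2_norm_eq_inner
  by (simp add: inner_add inner_diff inner_commute) (simp add: algebra_simps)

lemma convex_on_half_norm_squared_minus_iff:
  fixes f :: "'a::real_inner \<Rightarrow> real"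
  shows "convex_on UNIV (\<lambda>x. L / 2 * (norm x)\<^sup>2 - f x) \<longleftrightarrow>
    (\<forall>x y. \<forall>l\<in>{0..1}. f (l *\<^sub>R x + (1 - l) *\<^sub>R y)
       \<ge> l * f x + (1 - l) * f y - L / 2 * l * (1 - l) * (norm (x - y))\<^sup>2)"
    (is "convex_on UNIV ?\<psi> \<longleftrightarrow> ?chord")
proof -
  have *: "?\<psi> (l *\<^sub>R x + (1 - l) *\<^sub>R y) \<le> l * ?\<psi> x + (1 - l) * ?\<psi> y \<longleftrightarrow>
    f (l *\<^sub>R x + (1 - l) *\<^sub>R y)
       \<ge> l * f x + (1 - l) * f y - L / 2 * l * (1 - l) * (norm (x - y))\<^sup>2" for x y l
  proof -
    have "l * ?\<psi> x + (1 - l) * ?\<psi> y - ?\<psi> (l *\<^sub>R x + (1 - l) *\<^sub>R y)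
      = f (l *\<^sub>R x + (1 - l) *\<^sub>R y)
        - (l * f x + (1 - l) * f y - L / 2 * l * (1 - l) * (norm (x - y))\<^sup>2)"
      unfolding norm_squared_convex_combination by (simp add: field_simps)
    then show ?thesis by linarith
  qed
  show ?thesis
  proof
    assume conv: "convex_on UNIV ?\<psi>"
    show ?chord
    proof (intro allI ballI)
      fix x y :: 'a and l :: real
      assume "l \<in> {0..1}"
      then show "f (l *\<^sub>R x + (1 - l) *\<^sub>R y)
          \<ge> l * f x + (1 - l) * f y - L / 2 * l * (1 - l) * (norm (x - y))\<^sup>2"
        using convex_onD[OF conv, of "1 - l" x y] unfolding *[symmetric] by simp
    qed
  next
    assume chord: ?chord
    show "convex_on UNIV ?\<psi>"
    proof (rule convex_onI)
      fix t :: real and x y :: 'a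
      assume "0 < t" "t < 1"
      then show "?\<psi> ((1 - t) *\<^sub>R x + t *\<^sub>R y) \<le> (1 - t) * ?\<psi> x + t * ?\<psi> y"
        using chord[rule_format, of "1 - t" x y] *[of "1 - t" x y] by simp
    qed simp
  qed
qed

theorem proposition3p1:
  fixes f :: "real ^ 'd \<Rightarrow> real" and L :: real
  assumes "L \<ge> 0"
    and "f differentiable_on UNIV"
  shows "(L_smooth L f \<longleftrightarrow>
            (\<forall>x y. \<forall>l\<in>{0..1}.
               f (l *\<^sub>R x + (1 - l) *\<^sub>R y)
                 \<ge> l * f x + (1 - l) * f y - L / 2 * l * (1 - l) * (norm (x - y))\<^sup>2))
       \<and> (L_smooth L f \<longleftrightarrow>
            (\<forall>x y. (gradient f x - gradient f y) \<bullet> (x - y) \<le> L * (norm (x - y))\<^sup>2))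
       \<and> (L_smooth L f \<longleftrightarrow>
            (\<forall>x y. f y \<le> f x + gradient f x \<bullet> (y - x) + L / 2 * (norm (x - y))\<^sup>2))"
    (is "(_ \<longleftrightarrow> ?a) \<and> (_ \<longleftrightarrow> ?b) \<and> (_ \<longleftrightarrow> ?c)")
proof -
  define \<psi> where "\<psi> x = L / 2 * (norm x)\<^sup>2 - f x" for x
  define G where "G x = L *\<^sub>R x - gradient f x" for x
  have D: "GDERIV \<psi> x :> G x" for x
    unfolding \<psi>_def[abs_def] G_def
    using assms(2)
    by (intro GDERIV_diff GDERIV_half_norm_squared differentiable_imp_GDERIV_gradient)
       (simp add: differentiable_on_def)

  have a: "convex_on UNIV \<psi> \<longleftrightarrow> ?a"
    unfolding \<psi>_def[abs_def] by (rule convex_on_half_norm_squared_minus_iff)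
  have b: "(\<forall>x y. 0 \<le> (G x - G y) \<bullet> (x - y)) \<longleftrightarrow> ?b"
  proof -
    have "(G x - G y) \<bullet> (x - y)
        = L * (norm (x - y))\<^sup>2 - (gradient f x - gradient f y) \<bullet> (x - y)" for x y
      unfolding G_def power2_norm_eq_inner by (simp add: inner_diff algebra_simps)
    then show ?thesis by simp
  qed
  have c: "(\<forall>x y. \<psi> y + G y \<bullet> (x - y) \<le> \<psi> x) \<longleftrightarrow> ?c"
  proof -
    have "\<psi> x - (\<psi> y + G y \<bullet> (x - y))
        = f y + gradient f y \<bullet> (x - y) + L / 2 * (norm (y - x))\<^sup>2 - f x" for x y
      unfolding \<psi>_def G_def power2_norm_eq_inner
      by (simp add: inner_diff inner_commute) (simp add: field_simps)
    then have "\<psi> y + G y \<bullet> (x - y) \<le> \<psi> x \<longleftrightarrow>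
        f x \<le> f y + gradient f y \<bullet> (x - y) + L / 2 * (norm (y - x))\<^sup>2" for x y
      by (metis diff_ge_0_iff_ge)
    then show ?thesis by blast
  qed
  have smooth: "L_smooth L f \<longleftrightarrow> ?c"
  proof -
    have "bregman f x y \<le> L * bregman phi0 x y \<longleftrightarrow>
        f x \<le> f y + gradient f y \<bullet> (x - y) + L / 2 * (norm (y - x))\<^sup>2" for x y
      unfolding bregman_phi0 bregman_def[of f] norm_minus_commute[of x y] by auto
    then show ?thesis
      unfolding L_smooth_def using assms(2) by blast
  qed

  have "convex_on UNIV \<psi> \<Longrightarrow> \<forall>x y. \<psi> y + G y \<bullet> (x - y) \<le> \<psi> x"
    using convex_imp_above_tangent_gradient D by blast
  moreover have "\<forall>x y. \<psi> y + G y \<bullet> (x - y) \<le> \<psi> x \<Longrightarrow> \<forall>x y. 0 \<le> (G x - G y) \<bullet> (x - y)"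
    using above_tangent_imp_monotone_gradient[of \<psi> G] by blast
  moreover have "\<forall>x y. 0 \<le> (G x - G y) \<bullet> (x - y) \<Longrightarrow> convex_on UNIV \<psi>"
    using monotone_gradient_imp_convex[of \<psi> G] D by blast
  ultimately show ?thesis
    unfolding smooth a b c by blast
qed

end
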